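(* Let $E$ be an elliptic curve over $\mathbb{Q}$ such that $E(\mathbb{Q})[5]\neq\{0\}$. Assume moreover that the conductor of $E$ is $N_E=p^{\alpha}q^{\beta}$, where $p\neq q$ are primes and $\alpha,\beta>0$ are integers. Then, up to interchanging the names of $p$ and $q$, the absolute value $|\Delta_E|$ of the minimal discriminant is one of the following: $$2^5\cdot 5^2,\quad 2^{15}\cdot 5^2,\quad 3^5\cdot 5^2,\quad 13^5\cdot 5^2,\quad 37^5\cdot 31^2,\quad 7^5\cdot 5^3,\quad p^{5k}q^{2l+1}\ \text{ for some integers } k,l\ge 0.$$
   Context: For an elliptic curve $E/\mathbb{Q}$, $\Delta_E$ denotes its minimal discriminant and $N_E$ its conductor; these have the same prime divisors. $E(\mathbb{Q})[5]$ is the subgroup of points of $E(\mathbb{Q})$ killed by multiplication by $5$. *)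

theory Defs
  imports
    Complex_Main
    "HOL-Library.FuncSet"
    "HOL-Computational_Algebra.Computational_Algebra"
    "HOL-Algebra.Algebraic_Closure_Type"
    "HOL-Algebra.Generated_Fields"
    "HOL-Algebra.Ideal_Product"
begin

section \<open>Weierstrass equations\<close>

text \<open>
  \<open>Weierstrass a1 a2 a3 a4 a6\<close> is the equation
  \<open>y^2 + a1 x y + a3 y = x^3 + a2 x^2 + a4 x + a6\<close>.
\<close>

datatype 'a weierstrass = Weierstrass 'a 'a 'a 'a 'a

fun discriminant :: "'a::comm_ring_1 weierstrass \<Rightarrow> 'a" where
  "discriminant (Weierstrass a1 a2 a3 a4 a6) =
    (let b2 = a1^2 + 4 * a2;
         b4 = 2 * a4 + a1 * a3;
         b6 = a3^2 + 4 * a6;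
         b8 = a1^2 * a6 + 4 * a2 * a6 - a1 * a3 * a4 + a2 * a3^2 - a4^2
     in - (b2^2) * b8 - 8 * b4^3 - 27 * b6^2 + 9 * b2 * b4 * b6)"

definition elliptic_curve :: "'a::field weierstrass \<Rightarrow> bool" where
  "elliptic_curve E \<longleftrightarrow> discriminant E \<noteq> 0"

text \<open>
  The equation obtained from \<open>E\<close> by the substitution \<open>x = u^2 x' + r\<close>,
  \<open>y = u^3 y' + s u^2 x' + t\<close>, \<open>u \<noteq> 0\<close>. These are all the isomorphisms between curves given
  by Weierstrass equations.
\<close>

fun change_variables :: "'a::field \<Rightarrow> 'a \<Rightarrow> 'a \<Rightarrow> 'a \<Rightarrow> 'a weierstrass \<Rightarrow> 'a weierstrass" where
  "change_variables u r s t (Weierstrass a1 a2 a3 a4 a6) =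
    Weierstrass
      ((a1 + 2 * s) / u)
      ((a2 - s * a1 + 3 * r - s^2) / u^2)
      ((a3 + r * a1 + 2 * t) / u^3)
      ((a4 - s * a3 + 2 * r * a2 - (t + r * s) * a1 + 3 * r^2 - 2 * s * t) / u^4)
      ((a6 + r * a4 + r^2 * a2 + r^3 - t * a3 - t^2 - r * t * a1) / u^6)"

definition isomorphic :: "'a::field weierstrass \<Rightarrow> 'a weierstrass \<Rightarrow> bool" where
  "isomorphic E E' \<longleftrightarrow> (\<exists>u r s t. u \<noteq> 0 \<and> E' = change_variables u r s t E)"


section \<open>The group law\<close>

datatype 'a point = Infinity | Affine 'a 'a

fun on_curve :: "'a::field weierstrass \<Rightarrow> 'a point \<Rightarrow> bool" where
  "on_curve E Infinity \<longleftrightarrow> True"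
| "on_curve (Weierstrass a1 a2 a3 a4 a6) (Affine x y) \<longleftrightarrow>
    y^2 + a1 * x * y + a3 * y = x^3 + a2 * x^2 + a4 * x + a6"

text \<open>
  Chord and tangent law. The second branch of the conditional is the case where the second
  point is the negative \<open>(x1, - y1 - a1 x1 - a3)\<close> of the first one; in the last branch the
  points coincide and \<open>l\<close> is the slope of the tangent.
\<close>

fun add_point :: "'a::field weierstrass \<Rightarrow> 'a point \<Rightarrow> 'a point \<Rightarrow> 'a point" where
  "add_point E Infinity Q = Q"
| "add_point E (Affine x1 y1) Infinity = Affine x1 y1"
| "add_point (Weierstrass a1 a2 a3 a4 a6) (Affine x1 y1) (Affine x2 y2) =
    (let third = (\<lambda>l. let n = y1 - l * x1;
                          x3 = l^2 + a1 * l - a2 - x1 - x2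
                      in Affine x3 (- (l + a1) * x3 - n - a3))
     in if x1 \<noteq> x2 then third ((y2 - y1) / (x2 - x1))
        else if y1 + y2 + a1 * x2 + a3 = 0 then Infinity
        else third ((3 * x1^2 + 2 * a2 * x1 + a4 - a1 * y1) / (2 * y1 + a1 * x1 + a3)))"

definition multiple :: "'a::field weierstrass \<Rightarrow> nat \<Rightarrow> 'a point \<Rightarrow> 'a point" where
  "multiple E n P = (add_point E P ^^ n) Infinity"

definition torsion :: "'a::field weierstrass \<Rightarrow> nat \<Rightarrow> 'a point set" where
  "torsion E n = {P. on_curve E P \<and> multiple E n P = Infinity}"


section \<open>Minimal models over the rationals\<close>

definition rat_valuation :: "nat \<Rightarrow> rat \<Rightarrow> int" where
  "rat_valuation p x =
    int (multiplicity (int p) (fst (quotient_of x))) -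
    int (multiplicity (int p) (snd (quotient_of x)))"

definition p_integral :: "nat \<Rightarrow> rat weierstrass \<Rightarrow> bool" where
  "p_integral p E \<longleftrightarrow> (\<forall>a \<in> set_weierstrass E. \<not> int p dvd snd (quotient_of a))"

definition minimal_at :: "nat \<Rightarrow> rat weierstrass \<Rightarrow> bool" where
  "minimal_at p E \<longleftrightarrow> p_integral p E \<and>
    (\<forall>E'. isomorphic E E' \<and> p_integral p E' \<longrightarrow>
       rat_valuation p (discriminant E) \<le> rat_valuation p (discriminant E'))"

definition global_minimal_model :: "rat weierstrass \<Rightarrow> int weierstrass \<Rightarrow> bool" where
  "global_minimal_model E W \<longleftrightarrow>
    isomorphic E (map_weierstrass of_int W) \<and>
    (\<forall>p. prime p \<longrightarrow> minimal_at p (map_weierstrass of_int W))"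

text \<open>
  Every elliptic curve over the rationals has a global minimal model. The discriminants of two
  such models differ by the 12th power of a unit of the integers, hence are equal; the reduction
  types are independent of the choice as well.
\<close>

definition minimal_model :: "rat weierstrass \<Rightarrow> int weierstrass" where
  "minimal_model E = (SOME W. global_minimal_model E W)"

definition minimal_discriminant :: "rat weierstrass \<Rightarrow> int" where
  "minimal_discriminant E = discriminant (minimal_model E)"


section \<open>Reduction types\<close>

text \<open>
  Both notions are applied to minimal equations only. Good reduction means that the reduced
  equation over the field with \<open>p\<close> elements defines an elliptic curve, i.e. has nonzero
  discriminant.
\<close>

definition good_reduction :: "nat \<Rightarrow> int weierstrass \<Rightarrow> bool" where
  "good_reduction p W \<longleftrightarrow> \<not> int p dvd discriminant W"

text \<open>
  Multiplicative reduction: the singular point \<open>(x, y)\<close> of the reduced curve is a node. Being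
  unique, the singular point is rational over the prime field. In coordinates centred at
  \<open>(x, y)\<close> the quadratic part of the equation is \<open>Y^2 + a1 X Y - (3 x + a2) X^2\<close>, and the point
  is a node iff the discriminant of this form is nonzero (this is also correct for \<open>p = 2\<close>).
\<close>

fun multiplicative_reduction :: "nat \<Rightarrow> int weierstrass \<Rightarrow> bool" where
  "multiplicative_reduction p (Weierstrass a1 a2 a3 a4 a6) \<longleftrightarrow>
    (\<exists>x y. int p dvd y^2 + a1 * x * y + a3 * y - (x^3 + a2 * x^2 + a4 * x + a6) \<and>
           int p dvd a1 * y - (3 * x^2 + 2 * a2 * x + a4) \<and>
           int p dvd 2 * y + a1 * x + a3 \<and>
           \<not> int p dvd a1^2 + 4 * (3 * x + a2))"


section \<open>Wild ramification of the torsion points\<close>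

definition division_field :: "rat weierstrass \<Rightarrow> nat \<Rightarrow> complex set" where
  "division_field E l =
    generate_field ring_of_type_algebra
      (\<Union>P \<in> torsion (map_weierstrass of_rat E) l. set_point P)"

definition subring_of_complex :: "complex set \<Rightarrow> complex ring" where
  "subring_of_complex S = ring_of_type_algebra\<lparr>carrier := S\<rparr>"

definition ring_of_integers :: "complex set \<Rightarrow> complex ring" where
  "ring_of_integers K = subring_of_complex {x \<in> K. algebraic_int x}"

text \<open>
  Field automorphisms of \<open>K\<close>, automatically trivial on the rationals. Extensionality makes
  them determined by their values on \<open>K\<close>.
\<close>

definition automorphisms :: "complex set \<Rightarrow> (complex \<Rightarrow> complex) set" where
  "automorphisms K =
    ring_iso (subring_of_complex K) (subring_of_complex K) \<inter> extensional K"

text \<open>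
  The ramification groups \<open>G\<^sub>i\<close>, \<open>i \<ge> 0\<close>, in the lower numbering at the prime \<open>\<P>\<close> of \<open>K\<close>: the
  automorphisms acting trivially modulo \<open>\<P>^(i+1)\<close> on the integers. They are contained in the
  decomposition group of \<open>\<P>\<close> and equal the ramification groups of the completion.
\<close>

definition ramification_group :: "complex set \<Rightarrow> complex set \<Rightarrow> nat \<Rightarrow> (complex \<Rightarrow> complex) set" where
  "ramification_group K \<P> i =
    {\<sigma> \<in> automorphisms K. \<forall>x \<in> carrier (ring_of_integers K).
       \<sigma> x - x \<in> (ideal_prod (ring_of_integers K) \<P> ^^ i) \<P>}"

definition fixed_torsion ::
    "rat weierstrass \<Rightarrow> nat \<Rightarrow> (complex \<Rightarrow> complex) set \<Rightarrow> complex point set" where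
  "fixed_torsion E l H =
    {T \<in> torsion (map_weierstrass of_rat E) l. \<forall>\<sigma> \<in> H. map_point \<sigma> T = T}"

text \<open>
  For a prime \<open>l\<close> different from the residue characteristic of \<open>\<P>\<close>,
  \<open>\<delta> = (\<Sum>i\<ge>1. g\<^sub>i / g\<^sub>0 * dim (E[l] / E[l]^G\<^sub>i))\<close>, where \<open>g\<^sub>i = |G\<^sub>i|\<close> and the dimension is
  taken over the field with \<open>l\<close> elements; as \<open>G\<^sub>i\<close> is trivial for large \<open>i\<close>, only finitely
  many terms are nonzero. The sum is a nonnegative integer, so that taking the floor merely
  adapts the type.
\<close>

definition wild_exponent_at :: "rat weierstrass \<Rightarrow> nat \<Rightarrow> complex set \<Rightarrow> nat" where
  "wild_exponent_at E l \<P> =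
    (let G = ramification_group (division_field E l) \<P>
     in nat \<lfloor>\<Sum>i. real (card (G (Suc i))) / real (card (G 0)) *
                log (real l) (real (card (fixed_torsion E l {})) /
                              real (card (fixed_torsion E l (G (Suc i)))))\<rfloor>)"

text \<open>The value does not depend on the choice of \<open>l \<noteq> p\<close> and of the prime above \<open>p\<close>.\<close>

definition wild_exponent :: "rat weierstrass \<Rightarrow> nat \<Rightarrow> nat" where
  "wild_exponent E p =
    (let l = (SOME l. prime l \<and> l \<noteq> p);
         \<P> = (SOME \<P>. primeideal \<P> (ring_of_integers (division_field E l)) \<and> of_nat p \<in> \<P>)
     in wild_exponent_at E l \<P>)"


section \<open>The conductor\<close>

definition conductor_exponent :: "rat weierstrass \<Rightarrow> nat \<Rightarrow> nat" where
  "conductor_exponent E p =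
    (if good_reduction p (minimal_model E) then 0
     else if multiplicative_reduction p (minimal_model E) then 1
     else 2 + wild_exponent E p)"

definition conductor :: "rat weierstrass \<Rightarrow> nat" where
  "conductor E = (\<Prod>p | prime p \<and> conductor_exponent E p \<noteq> 0. p ^ conductor_exponent E p)"

end

theory Submission
  imports Defs
begin

text \<open>
  Moving a rational point of order 5 to the origin with horizontal tangent and rescaling gives
  Tate's normal form; clearing denominators, \<open>E\<close> is isomorphic to
  \<open>y^2 + (b - a) x y - a b^2 y = x^3 - a b x^2\<close> with coprime \<open>a\<close>, \<open>b\<close>, whose discriminant is
  \<open>a^5 b^5 f\<close> with \<open>f = a^2 - 11 a b - b^2\<close>. No prime \<open>p\<close> has \<open>p^4\<close> dividing \<open>c4\<close> and \<open>p^12\<close>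
  dividing the discriminant, so this model is minimal everywhere.

  The primes dividing the conductor are those dividing the minimal discriminant, so the pairwise
  coprime numbers \<open>a\<close>, \<open>b\<close>, \<open>f\<close> have exactly two prime divisors altogether. If \<open>f\<close> is a unit, then
  \<open>a\<close> and \<open>b\<close> are prime powers, and they cannot both be squares up to sign. Otherwise one of
  \<open>a\<close>, \<open>b\<close> is a unit, the other one a power of \<open>p\<close>, and \<open>f\<close> is up to sign a power of \<open>q\<close>. If the
  exponent of \<open>q\<close> is even, \<open>x = a b\<close> satisfies \<open>x^2 - 11 x - 1 = s^2\<close> or \<open>- s^2\<close>, which after
  completing the square leaves finitely many cases.
\<close>

section \<open>Changes of variables\<close>

text \<open>The classical invariant \<open>b2^2 - 24 * b4\<close> of weight 4; together with the
  discriminant it bounds how far a model can be shrunk at a prime.\<close>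

fun c4 :: "'a::comm_ring_1 weierstrass \<Rightarrow> 'a" where
  "c4 (Weierstrass a1 a2 a3 a4 a6) = (a1^2 + 4 * a2)^2 - 24 * (2 * a4 + a1 * a3)"

text \<open>
  Expressing the old coefficients as polynomials in the new ones turns all invariance statements
  into identities without denominators.
\<close>

lemma change_variables_cases:
  fixes E :: "'a::field weierstrass"
  assumes "u \<noteq> 0"
  obtains A1 A2 A3 A4 A6 where "change_variables u r s t E = Weierstrass A1 A2 A3 A4 A6"
    "E = Weierstrass
      (u * A1 - 2 * s)
      (u^2 * A2 + s * u * A1 - 3 * r - s^2)
      (u^3 * A3 - r * u * A1 + 2 * r * s - 2 * t)
      (u^4 * A4 + s * u^3 * A3 - 2 * r * u^2 * A2 + (t - 2 * r * s) * u * A1 + 3 * r^2 + 2 * r * s^2 - 2 * s * t)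
      (u^6 * A6 - r * u^4 * A4 + (t - r * s) * u^3 * A3 + r^2 * u^2 * A2 + (r^2 * s - r * t) * u * A1
        - r^3 - r^2 * s^2 + 2 * r * s * t - t^2)"
proof -
  obtain a1 a2 a3 a4 a6 where E: "E = Weierstrass a1 a2 a3 a4 a6" by (cases E)
  obtain A1 A2 A3 A4 A6 where A: "A1 = (a1 + 2 * s) / u"
    "A2 = (a2 - s * a1 + 3 * r - s^2) / u^2"
    "A3 = (a3 + r * a1 + 2 * t) / u^3"
    "A4 = (a4 - s * a3 + 2 * r * a2 - (t + r * s) * a1 + 3 * r^2 - 2 * s * t) / u^4"
    "A6 = (a6 + r * a4 + r^2 * a2 + r^3 - t * a3 - t^2 - r * t * a1) / u^6"
    by blast
  have a1: "a1 = u * A1 - 2 * s" using assms by (simp add: A)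
  have "a2 = u^2 * A2 + s * a1 - 3 * r + s^2"
    and "a3 = u^3 * A3 - r * a1 - 2 * t"
    and "a4 = u^4 * A4 + s * a3 - 2 * r * a2 + (t + r * s) * a1 - 3 * r^2 + 2 * s * t"
    and "a6 = u^6 * A6 - r * a4 - r^2 * a2 - r^3 + t * a3 + t^2 + r * t * a1"
    using assms by (simp_all add: A)
  note a = this(1)[unfolded a1] this(2)[unfolded a1] this(3-)
  have "a2 = u^2 * A2 + s * u * A1 - 3 * r - s^2"
    and "a3 = u^3 * A3 - r * u * A1 + 2 * r * s - 2 * t"
    by (simp_all add: a algebra_simps numeral_eq_Suc)
  note a' = this a(3)[unfolded a1 this] a(4)
  have "a4 = u^4 * A4 + s * u^3 * A3 - 2 * r * u^2 * A2 + (t - 2 * r * s) * u * A1 + 3 * r^2 + 2 * r * s^2 - 2 * s * t"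
    unfolding a'(3) by (simp add: algebra_simps numeral_eq_Suc)
  note a'' = this a'(4)[unfolded a1 a'(1,2) this]
  have "a6 = u^6 * A6 - r * u^4 * A4 + (t - r * s) * u^3 * A3 + r^2 * u^2 * A2 + (r^2 * s - r * t) * u * A1
        - r^3 - r^2 * s^2 + 2 * r * s * t - t^2"
    unfolding a''(2) by (simp add: algebra_simps numeral_eq_Suc)
  with a1 a'(1,2) a''(1) show ?thesis
    using that[of A1 A2 A3 A4 A6] E A by simp
qed

text \<open>The parameters on the right come from inserting one substitution into the other.\<close>

lemma change_variables_comp:
  fixes E :: "'a::field weierstrass"
  assumes u: "u \<noteq> 0"
  shows "change_variables u' r' s' t' (change_variables u r s t E) =
    change_variables (u * u') (u^2 * r' + r) (u * s' + s) (u^3 * t' + u^2 * s * r' + t) E"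
proof (rule change_variables_cases[OF u, of r s t E], goal_cases)
  case (1 A1 A2 A3 A4 A6)
  let ?r = "u^2 * r' + r" and ?s = "u * s' + s" and ?t = "u^3 * t' + u^2 * s * r' + t"
  obtain a1 a2 a3 a4 a6 where E: "E = Weierstrass a1 a2 a3 a4 a6" by (cases E)
  note a = 1(2)[unfolded E weierstrass.inject]
  have "a1 + 2 * ?s = u * (A1 + 2 * s')"
    and "a2 - ?s * a1 + 3 * ?r - ?s^2 = u^2 * (A2 - s' * A1 + 3 * r' - s'^2)"
    and "a3 + ?r * a1 + 2 * ?t = u^3 * (A3 + r' * A1 + 2 * t')"
    and "a4 - ?s * a3 + 2 * ?r * a2 - (?t + ?r * ?s) * a1 + 3 * ?r^2 - 2 * ?s * ?t
      = u^4 * (A4 - s' * A3 + 2 * r' * A2 - (t' + r' * s') * A1 + 3 * r'^2 - 2 * s' * t')"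
    and "a6 + ?r * a4 + ?r^2 * a2 + ?r^3 - ?t * a3 - ?t^2 - ?r * ?t * a1
      = u^6 * (A6 + r' * A4 + r'^2 * A2 + r'^3 - t' * A3 - t'^2 - r' * t' * A1)"
    by (simp_all add: a algebra_simps numeral_eq_Suc)
  then show ?case
    unfolding 1(1) unfolding E change_variables.simps using u by (simp add: power_mult_distrib)
qed

lemma change_variables_id: "change_variables 1 0 0 0 E = E"
  by (cases E) simp

lemma isomorphic_trans:
  assumes "isomorphic E E'" "isomorphic E' E''"
  shows "isomorphic E E''"
  using assms change_variables_comp unfolding isomorphic_def by (metis mult_eq_0_iff)

lemma isomorphic_sym:
  fixes E :: "'a::field weierstrass"
  assumes "isomorphic E E'"
  shows "isomorphic E' E"
proof -
  obtain u r s t where u: "u \<noteq> 0" and E': "E' = change_variables u r s t E"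
    using assms unfolding isomorphic_def by blast
  \<comment> \<open>These parameters belong to the inverse substitution
    \<open>x' = (x - r) / u^2\<close>, \<open>y' = (y - s * (x - r) - t) / u^3\<close>.\<close>
  have "change_variables (1/u) (- r/u^2) (- s/u) ((r * s - t)/u^3) E' = E"
    unfolding E' change_variables_comp[OF u] using u
    by (simp add: change_variables_id power2_eq_square power3_eq_cube field_simps)
  then show ?thesis
    using u unfolding isomorphic_def by (metis divide_eq_0_iff zero_neq_one)
qed

text \<open>The substitution changes \<open>b2\<close> and \<open>b4\<close> by terms in
  \<open>r\<close>, which cancel in \<open>b2^2 - 24 * b4\<close>.\<close>

lemma c4_change_variables:
  fixes E :: "'a::field weierstrass"
  assumes u: "u \<noteq> 0"
  shows "u^4 * c4 (change_variables u r s t E) = c4 E"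
proof (rule change_variables_cases[OF u, of r s t E], goal_cases)
  case (1 A1 A2 A3 A4 A6)
  obtain a1 a2 a3 a4 a6 where E: "E = Weierstrass a1 a2 a3 a4 a6" by (cases E)
  note a = 1(2)[unfolded E weierstrass.inject]
  define B2 B4 where B: "B2 = A1^2 + 4 * A2" "B4 = 2 * A4 + A1 * A3"
  have b: "a1^2 + 4 * a2 = u^2 * B2 - 12 * r"
    "2 * a4 + a1 * a3 = u^4 * B4 - r * u^2 * B2 + 6 * r^2"
    by (simp_all add: a B algebra_simps numeral_eq_Suc)
  show ?case
    unfolding 1(1) unfolding E c4.simps b B[symmetric] by (simp add: algebra_simps numeral_eq_Suc)
qed

lemma discriminant_change_variables:
  fixes E :: "'a::field weierstrass"
  assumes u: "u \<noteq> 0"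
  shows "u^12 * discriminant (change_variables u r s t E) = discriminant E"
proof (rule change_variables_cases[OF u, of r s t E], goal_cases)
  case (1 A1 A2 A3 A4 A6)
  obtain a1 a2 a3 a4 a6 where E: "E = Weierstrass a1 a2 a3 a4 a6" by (cases E)
  note a = 1(2)[unfolded E weierstrass.inject]
  define B2 B4 B6 B8 where B: "B2 = A1^2 + 4 * A2" "B4 = 2 * A4 + A1 * A3" "B6 = A3^2 + 4 * A6"
    "B8 = A1^2 * A6 + 4 * A2 * A6 - A1 * A3 * A4 + A2 * A3^2 - A4^2"
  have b: "a1^2 + 4 * a2 = u^2 * B2 - 12 * r"
    "2 * a4 + a1 * a3 = u^4 * B4 - r * u^2 * B2 + 6 * r^2"
    "a3^2 + 4 * a6 = u^6 * B6 - 2 * r * u^4 * B4 + r^2 * u^2 * B2 - 4 * r^3"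
    "a1^2 * a6 + 4 * a2 * a6 - a1 * a3 * a4 + a2 * a3^2 - a4^2
      = u^8 * B8 - 3 * r * u^6 * B6 + 3 * r^2 * u^4 * B4 - r^3 * u^2 * B2 + 3 * r^4"
    by (simp_all add: a B algebra_simps numeral_eq_Suc)
  \<comment> \<open>The two discriminants agree only modulo this relation; the last term below is its multiple.\<close>
  have "4 * B8 = B2 * B6 - B4^2" unfolding B by (simp add: algebra_simps numeral_eq_Suc)
  moreover have "u^12 * (- (B2^2) * B8 - 8 * B4^3 - 27 * B6^2 + 9 * B2 * B4 * B6) =
    - ((u^2 * B2 - 12 * r)^2) * (u^8 * B8 - 3 * r * u^6 * B6 + 3 * r^2 * u^4 * B4 - r^3 * u^2 * B2 + 3 * r^4)
    - 8 * (u^4 * B4 - r * u^2 * B2 + 6 * r^2)^3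
    - 27 * (u^6 * B6 - 2 * r * u^4 * B4 + r^2 * u^2 * B2 - 4 * r^3)^2
    + 9 * (u^2 * B2 - 12 * r) * (u^4 * B4 - r * u^2 * B2 + 6 * r^2)
        * (u^6 * B6 - 2 * r * u^4 * B4 + r^2 * u^2 * B2 - 4 * r^3)
    - (6 * r * u^10 * B2 - 36 * r^2 * u^8) * (4 * B8 - (B2 * B6 - B4^2))"
    by (simp add: algebra_simps numeral_eq_Suc)
  ultimately show ?case
    unfolding 1(1) unfolding E discriminant.simps Let_def b B[symmetric] by simp
qed

text \<open>Leads from the transformed curve back to the original one; in this direction the
  substitution needs no division.\<close>

fun original_point :: "'a::field \<Rightarrow> 'a \<Rightarrow> 'a \<Rightarrow> 'a \<Rightarrow> 'a point \<Rightarrow> 'a point" where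
  "original_point u r s t Infinity = Infinity"
| "original_point u r s t (Affine x y) = Affine (u^2 * x + r) (u^3 * y + s * u^2 * x + t)"

lemma original_point_eq_Infinity [simp]: "original_point u r s t P = Infinity \<longleftrightarrow> P = Infinity"
  by (cases P) auto

text \<open>
  The condition on \<open>P\<close> excludes a vertical tangent: for points off the curve the last branch of
  \<open>add_point\<close> could then divide by zero, and the junk value \<open>0\<close> of the slope is not covariant.
\<close>

lemma original_point_add_point:
  fixes E :: "'a::field weierstrass"
  assumes u: "u \<noteq> 0" and P: "add_point (change_variables u r s t E) P P \<noteq> Infinity"
  shows "add_point E (original_point u r s t P) (original_point u r s t Q) =
    original_point u r s t (add_point (change_variables u r s t E) P Q)"
proof (rule change_variables_cases[OF u, of r s t E], goal_cases)
  case (1 A1 A2 A3 A4 A6)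
  obtain a1 a2 a3 a4 a6 where E: "E = Weierstrass a1 a2 a3 a4 a6" by (cases E)
  note a = 1(2)[unfolded E weierstrass.inject]
  \<comment> \<open>A line of slope \<open>L\<close> in the new coordinates has slope
    \<open>u * L + s\<close> in the old ones; the point that \<open>add_point\<close> computes from
    the slope transforms accordingly.\<close>
  have third: "l^2 + a1 * l - a2 - (u^2 * x1 + r) - (u^2 * x2 + r) = u^2 * (L^2 + A1 * L - A2 - x1 - x2) + r"
    "- (l + a1) * (u^2 * z + r) - (u^3 * y1 + s * u^2 * x1 + t - l * (u^2 * x1 + r)) - a3
      = u^3 * (- (L + A1) * z - (y1 - L * x1) - A3) + s * u^2 * z + t"
    if "l = u * L + s" for l L x1 x2 y1 z
    by (simp_all add: a that algebra_simps numeral_eq_Suc)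
  note third = this[OF refl]
  have x: "u^2 * x1 + r = u^2 * x2 + r \<longleftrightarrow> x1 = x2" for x1 x2
    using u by simp
  show ?case
  proof (cases P; cases Q)
    fix x1 y1 x2 y2
    assume PQ: "P = Affine x1 y1" "Q = Affine x2 y2"
    show ?thesis
    proof (cases "x1 = x2")
      case False
      have "((u^3 * y2 + s * u^2 * x2 + t) - (u^3 * y1 + s * u^2 * x1 + t)) / ((u^2 * x2 + r) - (u^2 * x1 + r)) = u * ((y2 - y1) / (x2 - x1)) + s"
        (is "?n / ?d = _")
      proof -
        have "?d = u^2 * (x2 - x1)" "?n = u^3 * (y2 - y1) + s * u^2 * (x2 - x1)"
          by (simp_all add: algebra_simps)
        then show ?thesis
          using u False by (simp add: add_divide_distrib power2_eq_square power3_eq_cube)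
      qed
      then show ?thesis
        unfolding PQ 1(1) unfolding E original_point.simps add_point.simps Let_def x
        using False by (simp only: third if_False if_True simp_thms original_point.simps)
    next
      case True
      have sum: "(u^3 * y1 + s * u^2 * x1 + t) + (u^3 * y2 + s * u^2 * x2 + t) + a1 * (u^2 * x2 + r) + a3
          = u^3 * (y1 + y2 + A1 * x2 + A3)"
        and d: "2 * (u^3 * y1 + s * u^2 * x1 + t) + a1 * (u^2 * x1 + r) + a3 = u^3 * (2 * y1 + A1 * x1 + A3)"
        using True by (simp_all add: a algebra_simps numeral_eq_Suc)
      have n: "3 * (u^2 * x1 + r)^2 + 2 * a2 * (u^2 * x1 + r) + a4 - a1 * (u^3 * y1 + s * u^2 * x1 + t)
        = u^4 * (3 * x1^2 + 2 * A2 * x1 + A4 - A1 * y1) + s * (u^3 * (2 * y1 + A1 * x1 + A3))"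
        by (simp add: a algebra_simps numeral_eq_Suc)
      show ?thesis
      proof (cases "y1 + y2 + A1 * x2 + A3 = 0")
        case neg: True
        then show ?thesis
          unfolding PQ 1(1) unfolding E original_point.simps add_point.simps Let_def sum
          using True by simp
      next
        case neg: False
        \<comment> \<open>The case assumption \<open>neg\<close> is about \<open>y1 + y2\<close>;
          the denominator of the tangent slope, which has \<open>2 * y1\<close>, is nonzero because
          doubling \<open>P\<close> does not give \<open>Infinity\<close>.\<close>
        have "2 * y1 + A1 * x1 + A3 \<noteq> 0"
          using P unfolding PQ 1(1) by (auto simp: algebra_simps)
        then have "(u^4 * (3 * x1^2 + 2 * A2 * x1 + A4 - A1 * y1) + s * (u^3 * (2 * y1 + A1 * x1 + A3)))
           / (u^3 * (2 * y1 + A1 * x1 + A3))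
          = u * ((3 * x1^2 + 2 * A2 * x1 + A4 - A1 * y1) / (2 * y1 + A1 * x1 + A3)) + s"
          using u by (simp add: add_divide_distrib power_numeral_reduce)
        then show ?thesis
          unfolding PQ 1(1) unfolding E original_point.simps add_point.simps Let_def sum d n x
          using u True neg
          by (simp only: third if_False if_True simp_thms original_point.simps mult_eq_0_iff power_eq_0_iff)
      qed
    qed
  qed simp_all
qed

section \<open>Tate's normal form\<close>

text \<open>Every addition in \<open>multiple\<close> has \<open>P\<close> as its first summand, so
  one condition on \<open>P\<close> covers all of them.\<close>

lemma original_point_multiple:
  fixes E :: "'a::field weierstrass"
  assumes "u \<noteq> 0" "add_point (change_variables u r s t E) P P \<noteq> Infinity"
  shows "multiple E n (original_point u r s t P) =
    original_point u r s t (multiple (change_variables u r s t E) n P)"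
  unfolding multiple_def by (induction n) (simp_all add: original_point_add_point assms)

lemma multiple_5:
  "multiple E 5 P = add_point E P (add_point E P (add_point E P (add_point E P (add_point E P Infinity))))"
  by (simp add: multiple_def numeral_eq_Suc)

lemma add_point_Infinity [simp]: "add_point E P Infinity = P"
  by (cases P) auto

text \<open>The multiples of the origin are computed one by one. If \<open>c \<noteq> d\<close>, the
  fourth one is either \<open>Infinity\<close> or an affine point with nonzero first coordinate, and
  adding the origin cannot give \<open>Infinity\<close>.\<close>

lemma multiple_5_origin:
  fixes c d :: "'a::field"
  assumes "d \<noteq> 0" and "multiple (Weierstrass (1 - c) (-d) (-d) 0 0) 5 (Affine 0 0) = Infinity"
  shows "c = d"
proof (rule ccontr)
  assume "c \<noteq> d"
  let ?E = "Weierstrass (1 - c) (-d) (-d) 0 0" and ?P = "Affine (0::'a) 0"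
  have 2: "add_point ?E ?P ?P = Affine d (c * d)"
    using \<open>d \<noteq> 0\<close> by (simp add: Let_def algebra_simps)
  have 3: "add_point ?E ?P (Affine d (c * d)) = Affine c (d - c)"
    using \<open>d \<noteq> 0\<close> by (simp add: Let_def algebra_simps power2_eq_square)
  \<comment> \<open>For \<open>c = 0\<close> the third multiple is \<open>Affine 0 d\<close>, the
    negative of the origin; so the fourth is \<open>Infinity\<close> and the fifth is the origin
    itself.\<close>
  have "c \<noteq> 0"
  proof
    assume "c = 0"
    then show False
      using assms 2 3 by (simp add: multiple_5)
  qed
  define l where "l = (d - c) / c"
  have l: "l * c = d - c" using \<open>c \<noteq> 0\<close> by (simp add: l_def)
  have "add_point ?E ?P (Affine c (d - c)) = Affine (l * (l + 1)) (d - (l + 1 - c) * (l * (l + 1)))"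
    using \<open>c \<noteq> 0\<close> l l_def[symmetric]
    by (simp add: Let_def) (simp add: algebra_simps power2_eq_square)
  moreover have "l * (l + 1) \<noteq> 0"
  proof -
    have "l \<noteq> 0" "l + 1 \<noteq> 0" using \<open>c \<noteq> d\<close> \<open>c \<noteq> 0\<close> \<open>d \<noteq> 0\<close> by (auto simp: l_def field_simps)
    then show ?thesis by simp
  qed
  ultimately show False
    using assms(2) 2 3 by (simp add: multiple_5 Let_def)
qed

lemma five_torsion_Tate_normal_form:
  fixes E :: "'a::field weierstrass"
  assumes "torsion E 5 \<noteq> {Infinity}"
  obtains d where "d \<noteq> 0" "isomorphic E (Weierstrass (1 - d) (- d) (- d) 0 0)"
proof -
  obtain a1 a2 a3 a4 a6 where E: "E = Weierstrass a1 a2 a3 a4 a6" by (cases E)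
  have "Infinity \<in> torsion E 5" by (simp add: torsion_def multiple_5)
  then obtain P where "P \<in> torsion E 5" "P \<noteq> Infinity" using assms by blast
  then obtain x y where P: "on_curve E (Affine x y)" "multiple E 5 (Affine x y) = Infinity"
    by (cases P) (auto simp: torsion_def)
  \<comment> \<open>The denominator of the tangent slope. If it vanished, the point would have order
    2 and equal its own fifth multiple.\<close>
  define D where "D = 2 * y + a1 * x + a3"
  have "D \<noteq> 0"
  proof
    assume "D = 0"
    then have "add_point E (Affine x y) (Affine x y) = Infinity"
      by (simp add: E D_def algebra_simps)
    then show False using P(2) by (simp add: multiple_5)
  qed
  \<comment> \<open>With \<open>s\<close> the tangent slope, the shear makes the tangent horizontal,
    which kills \<open>a4\<close>; moving the point to the origin kills \<open>a6\<close>.\<close>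
  define s where "s = (3 * x^2 + 2 * a2 * x + a4 - a1 * y) / D"
  define b1 b2 where "b1 = a1 + 2 * s" and "b2 = a2 - s * a1 + 3 * x - s^2"
  have "a4 - s * a3 + 2 * x * a2 - (y + x * s) * a1 + 3 * x^2 - 2 * s * y = 3 * x^2 + 2 * a2 * x + a4 - a1 * y - s * D"
    by (simp add: D_def algebra_simps)
  then have a4: "a4 - s * a3 + 2 * x * a2 - (y + x * s) * a1 + 3 * x^2 - 2 * s * y = 0"
    using \<open>D \<noteq> 0\<close> by (simp add: s_def)
  have E': "change_variables 1 x s y E = Weierstrass b1 b2 D 0 0" (is "_ = ?E'")
    using P(1) a4 by (simp add: E b1_def b2_def D_def algebra_simps power2_eq_square)
  have "add_point ?E' (Affine 0 0) (Affine 0 0) \<noteq> Infinity" using \<open>D \<noteq> 0\<close> by (simp add: Let_def)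
  from original_point_multiple[where E=E and P = "Affine 0 0" and u = 1 and r = x and s = s and t = y and n = 5, unfolded E', OF _ this]
  have m': "multiple ?E' 5 (Affine 0 0) = Infinity"
    using P(2) by (simp add: eq_commute[of Infinity])
  \<comment> \<open>For \<open>b2 = 0\<close> the horizontal tangent would meet the curve three
    times at the origin; the origin would have order 3 and its fifth multiple would be the second
    one.\<close>
  have "b2 \<noteq> 0"
    using m' \<open>D \<noteq> 0\<close> by (auto simp: multiple_5 Let_def)
  \<comment> \<open>Chosen so that \<open>D / u^3 = b2 / u^2\<close>: after rescaling, the second
    and third coefficients agree.\<close>
  define u where "u = D / b2"
  have u: "u \<noteq> 0" using \<open>D \<noteq> 0\<close> \<open>b2 \<noteq> 0\<close> by (simp add: u_def)
  define c d where "c = 1 - b1 / u" and "d = - (b2 / u^2)"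
  have "d \<noteq> 0" using u \<open>b2 \<noteq> 0\<close> by (simp add: d_def)
  have E'': "change_variables u 0 0 0 ?E' = Weierstrass (1 - c) (- d) (- d) 0 0" (is "_ = ?E''")
    using u \<open>D \<noteq> 0\<close> \<open>b2 \<noteq> 0\<close> by (simp add: c_def d_def) (simp add: u_def field_simps power2_eq_square power3_eq_cube)
  have "add_point ?E'' (Affine 0 0) (Affine 0 0) \<noteq> Infinity" using \<open>d \<noteq> 0\<close> by (simp add: Let_def)
  from original_point_multiple[where E="?E'" and P = "Affine 0 0" and u = u and r = 0 and s = 0 and t = 0 and n = 5, unfolded E'', OF u this]
  have "multiple ?E'' 5 (Affine 0 0) = Infinity"
    using m' by (simp add: eq_commute[of Infinity])
  then have "c = d" by (rule multiple_5_origin[OF \<open>d \<noteq> 0\<close>])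
  moreover have "isomorphic E ?E'" "isomorphic ?E' ?E''"
    unfolding isomorphic_def using E' E'' u by (metis zero_neq_one)+
  ultimately show ?thesis
    using that \<open>d \<noteq> 0\<close> isomorphic_trans by metis
qed

section \<open>Minimality\<close>

lemma quotient_of_eq_divide:
  assumes "quotient_of x = (m, n)"
  shows "x = of_int m / of_int n" "n > 0" "coprime m n"
  using assms quotient_of_div quotient_of_denom_pos quotient_of_coprime by blast+

lemma rat_valuation_divide:
  assumes "prime p" "m \<noteq> 0" "n \<noteq> 0"
  shows "rat_valuation p (of_int m / of_int n) = int (multiplicity (int p) m) - int (multiplicity (int p) n)"
proof -
  obtain m' n' where q: "quotient_of (of_int m / of_int n) = (m', n')" by fastforce
  note * = quotient_of_eq_divide[OF q]
  have "prime (int p)" using assms by simp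
  have "(of_int (m * n') :: rat) = of_int (m' * n)"
    using *(1,2) assms by (simp add: field_simps)
  then have e: "m * n' = m' * n" using of_int_eq_iff by blast
  with *(2) assms have "m' \<noteq> 0" by auto
  have "multiplicity (int p) m + multiplicity (int p) n' = multiplicity (int p) m' + multiplicity (int p) n"
    using arg_cong[OF e, of "multiplicity (int p)"] assms \<open>m' \<noteq> 0\<close> *(2) \<open>prime (int p)\<close>
    by (simp add: prime_elem_multiplicity_mult_distrib)
  then show ?thesis by (simp add: rat_valuation_def q)
qed

lemma rat_valuation_of_int:
  "rat_valuation p (of_int m) = int (multiplicity (int p) m)"
  by (simp add: rat_valuation_def)

lemma rat_valuation_mult:
  assumes "prime p" "x \<noteq> 0" "y \<noteq> 0"
  shows "rat_valuation p (x * y) = rat_valuation p x + rat_valuation p y"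
proof -
  obtain a b where x: "quotient_of x = (a, b)" by fastforce
  obtain c d where y: "quotient_of y = (c, d)" by fastforce
  note x = quotient_of_eq_divide[OF x] and y = quotient_of_eq_divide[OF y]
  have nz: "a \<noteq> 0" "b \<noteq> 0" "c \<noteq> 0" "d \<noteq> 0" using x y assms by auto
  have "prime (int p)" using assms by simp
  have "rat_valuation p (x * y) = rat_valuation p (of_int (a * c) / of_int (b * d))"
    using x(1) y(1) by simp
  also have "\<dots> = rat_valuation p x + rat_valuation p y"
    using nz assms(1) \<open>prime (int p)\<close> unfolding x(1) y(1)
    by (subst (1 2 3) rat_valuation_divide) (simp_all add: prime_elem_multiplicity_mult_distrib)
  finally show ?thesis .
qed

lemma rat_valuation_power:
  assumes "prime p" "x \<noteq> 0"
  shows "rat_valuation p (x ^ n) = int n * rat_valuation p x"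
proof (induction n)
  case 0
  then show ?case by (simp add: rat_valuation_def)
next
  case (Suc n)
  then show ?case using assms by (simp add: rat_valuation_mult algebra_simps)
qed

text \<open>The localization of the integers at \<open>p\<close>. As a set with closure rules for
  the simplifier it shows that polynomials in integral coefficients are integral.\<close>

definition local_integers :: "nat \<Rightarrow> rat set" where
  "local_integers p = {x. \<not> int p dvd snd (quotient_of x)}"

text \<open>Any fraction may be used, not only the reduced one, so sums and products need no
  cancellation.\<close>

lemma local_integers_iff:
  assumes "prime p"
  shows "x \<in> local_integers p \<longleftrightarrow> (\<exists>m n. x = of_int m / of_int n \<and> \<not> int p dvd n)"
proof
  assume "x \<in> local_integers p"
  then show "\<exists>m n. x = of_int m / of_int n \<and> \<not> int p dvd n"
    using quotient_of_eq_divide[of x] unfolding local_integers_def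
    by (metis mem_Collect_eq prod.collapse)
next
  assume "\<exists>m n. x = of_int m / of_int n \<and> \<not> int p dvd n"
  then obtain m n where x: "x = of_int m / of_int n" "\<not> int p dvd n" by blast
  then have "n \<noteq> 0" by auto
  obtain m' n' where q: "quotient_of x = (m', n')" by fastforce
  note * = quotient_of_eq_divide[OF q]
  have "(of_int (m * n') :: rat) = of_int (m' * n)"
    using *(1,2) x(1) \<open>n \<noteq> 0\<close> by (simp add: field_simps)
  then have "m * n' = m' * n" using of_int_eq_iff by blast
  then have "n' dvd n" using *(3) by (metis coprime_commute coprime_dvd_mult_right_iff dvd_triv_right)
  then show "x \<in> local_integers p" using x(2) dvd_trans by (auto simp: local_integers_def q)
qed

lemma local_integers_of_int [simp]: "prime p \<Longrightarrow> of_int m \<in> local_integers p"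
  by (auto simp: local_integers_def)

lemma local_integers_numeral [simp]: "prime p \<Longrightarrow> numeral m \<in> local_integers p"
  using local_integers_of_int[of p "numeral m"] by simp

lemma local_integers_mult [simp]:
  assumes "prime p" "x \<in> local_integers p" "y \<in> local_integers p"
  shows "x * y \<in> local_integers p"
proof -
  obtain a b c d where "x = of_int a / of_int b" "\<not> int p dvd b" "y = of_int c / of_int d" "\<not> int p dvd d"
    using assms by (auto simp: local_integers_iff)
  then have "x * y = of_int (a * c) / of_int (b * d)" "\<not> int p dvd b * d"
    using assms(1) by (auto simp: prime_dvd_mult_iff)
  then show ?thesis using assms(1) local_integers_iff by blast
qed

lemma local_integers_add [simp]:
  assumes "prime p" "x \<in> local_integers p" "y \<in> local_integers p"
  shows "x + y \<in> local_integers p"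
proof -
  obtain a b c d where *: "x = of_int a / of_int b" "\<not> int p dvd b" "y = of_int c / of_int d" "\<not> int p dvd d"
    using assms by (auto simp: local_integers_iff)
  then have "b \<noteq> 0" "d \<noteq> 0" by auto
  with * have "x + y = of_int (a * d + c * b) / of_int (b * d)" "\<not> int p dvd b * d"
    using assms(1) by (auto simp: prime_dvd_mult_iff add_frac_eq)
  then show ?thesis using assms(1) local_integers_iff by blast
qed

lemma local_integers_diff [simp]:
  assumes "prime p" "x \<in> local_integers p" "y \<in> local_integers p"
  shows "x - y \<in> local_integers p"
  using local_integers_add[OF assms(1,2) local_integers_mult[OF assms(1) local_integers_of_int[OF assms(1), of "-1"] assms(3)]]
  by simp

lemma local_integers_power [simp]:
  assumes "prime p" "x \<in> local_integers p"
  shows "x ^ n \<in> local_integers p"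
  using assms local_integers_of_int[of p 1] by (induction n) simp_all

lemma local_integers_uminus [simp]:
  assumes "prime p" "x \<in> local_integers p"
  shows "- x \<in> local_integers p"
  using local_integers_diff[OF assms(1) local_integers_of_int[OF assms(1), of 0] assms(2)] by simp

lemma p_integral_Weierstrass:
  "p_integral p (Weierstrass a1 a2 a3 a4 a6) \<longleftrightarrow> {a1, a2, a3, a4, a6} \<subseteq> local_integers p"
  by (simp add: p_integral_def local_integers_def)

lemma p_integral_discriminant:
  assumes "prime p" "p_integral p E"
  shows "discriminant E \<in> local_integers p"
  using assms by (cases E) (simp add: p_integral_Weierstrass Let_def)

lemma p_integral_c4:
  assumes "prime p" "p_integral p E"
  shows "c4 E \<in> local_integers p"
  using assms by (cases E) (simp add: p_integral_Weierstrass)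

lemma p_integral_of_int:
  assumes "prime p"
  shows "p_integral p (map_weierstrass of_int W)"
  using assms by (cases W) (auto simp: p_integral_def)

lemma rat_valuation_nonneg:
  assumes "prime p" "x \<in> local_integers p"
  shows "rat_valuation p x \<ge> 0"
  using assms by (simp add: local_integers_def rat_valuation_def not_dvd_imp_multiplicity_0)

section \<open>Minimality of integral equations and the primes of the conductor\<close>

lemma discriminant_of_int: "discriminant (map_weierstrass of_int W) = of_int (discriminant W)"
  by (cases W) (simp add: Let_def)

lemma c4_of_int: "c4 (map_weierstrass of_int W) = of_int (c4 W)"
  by (cases W) simp

text \<open>A \<open>p\<close>-integral equation of smaller valuation would arise from some
  \<open>u\<close> of positive valuation; then \<open>u^4 * c4 E' = c4 W\<close>, and likewise with
  \<open>u^12\<close> for the discriminants, forces both divisibilities.\<close>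

lemma minimal_at_of_int:
  assumes p: "prime p" and "discriminant W \<noteq> 0"
    and "\<not> (int p ^ 4 dvd c4 W \<and> int p ^ 12 dvd discriminant W)"
  shows "minimal_at p (map_weierstrass of_int W)"
  unfolding minimal_at_def
proof (intro conjI allI impI)
  let ?E = "map_weierstrass of_int W :: rat weierstrass"
  show "p_integral p ?E" using p by (rule p_integral_of_int)
  fix E' assume E': "isomorphic ?E E' \<and> p_integral p E'"
  then obtain u r s t where u: "u \<noteq> 0" and E'_def: "E' = change_variables u r s t ?E"
    unfolding isomorphic_def by blast
  have D: "u^12 * discriminant E' = of_int (discriminant W)"
    and c: "u^4 * c4 E' = of_int (c4 W)"
    unfolding E'_def using u
    by (simp_all add: discriminant_change_variables c4_change_variables discriminant_of_int c4_of_int)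
  have "discriminant E' \<noteq> 0" using D assms(2) by auto
  have vD: "12 * rat_valuation p u + rat_valuation p (discriminant E') = int (multiplicity (int p) (discriminant W))"
    using arg_cong[OF D, of "rat_valuation p"] p u \<open>discriminant E' \<noteq> 0\<close>
    by (simp add: rat_valuation_mult rat_valuation_power rat_valuation_of_int)
  have "rat_valuation p u \<le> 0"
  proof (rule ccontr)
    assume "\<not> rat_valuation p u \<le> 0"
    moreover have "rat_valuation p (discriminant E') \<ge> 0"
      using p E' by (simp add: rat_valuation_nonneg p_integral_discriminant)
    ultimately have "multiplicity (int p) (discriminant W) \<ge> 12" using vD by linarith
    then have 1: "int p ^ 12 dvd discriminant W" by (rule multiplicity_dvd')
    have "int p ^ 4 dvd c4 W"
    \<comment> \<open>The multiplicity in 0 is 0 by convention, so valuations say nothing there; but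
      everything divides 0.\<close>
    proof (cases "c4 W = 0")
      case False
      then have "c4 E' \<noteq> 0" using c by auto
      have "4 * rat_valuation p u + rat_valuation p (c4 E') = int (multiplicity (int p) (c4 W))"
        using arg_cong[OF c, of "rat_valuation p"] p u \<open>c4 E' \<noteq> 0\<close>
        by (simp add: rat_valuation_mult rat_valuation_power rat_valuation_of_int)
      moreover have "rat_valuation p (c4 E') \<ge> 0"
        using p E' by (simp add: rat_valuation_nonneg p_integral_c4)
      ultimately have "multiplicity (int p) (c4 W) \<ge> 4" using \<open>\<not> rat_valuation p u \<le> 0\<close> by linarith
      then show ?thesis by (rule multiplicity_dvd')
    qed simp
    with 1 assms(3) show False by blast
  qed
  then show "rat_valuation p (discriminant ?E) \<le> rat_valuation p (discriminant E')"
    using vD p by (simp add: discriminant_of_int rat_valuation_of_int)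
qed

text \<open>The two models are isomorphic and each is minimal against the other, so their
  discriminants have equal multiplicity at every prime.\<close>

lemma global_minimal_model_abs_discriminant_eq:
  assumes "elliptic_curve E" "global_minimal_model E W" "global_minimal_model E W'"
  shows "\<bar>discriminant W\<bar> = \<bar>discriminant W'\<bar>"
proof -
  let ?i = "map_weierstrass of_int :: int weierstrass \<Rightarrow> rat weierstrass"
  have iso: "isomorphic (?i W) (?i W')" "isomorphic (?i W') (?i W)"
    using assms isomorphic_sym isomorphic_trans unfolding global_minimal_model_def by blast+
  have nz: "discriminant V \<noteq> 0" if V: "global_minimal_model E V" for V
  proof -
    obtain u r s t where "u \<noteq> 0" "?i V = change_variables u r s t E"
      using V unfolding global_minimal_model_def isomorphic_def by blast
    then have "u^12 * of_int (discriminant V) = discriminant E"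
      using discriminant_change_variables[of u r s t E] by (simp add: discriminant_of_int[symmetric])
    then show ?thesis using assms(1) by (auto simp: elliptic_curve_def)
  qed
  have "multiplicity q (discriminant W) = multiplicity q (discriminant W')" if "prime q" for q
  proof -
    obtain p where p: "q = int p" "prime p"
    proof (rule that)
      show "q = int (nat q)" using prime_gt_0_int[OF \<open>prime q\<close>] by simp
      show "prime (nat q)" using \<open>prime q\<close> prime_int_nat_transfer by blast
    qed
    then have "minimal_at p (?i W)" "minimal_at p (?i W')"
      using assms unfolding global_minimal_model_def by blast+
    then have "rat_valuation p (discriminant (?i W)) = rat_valuation p (discriminant (?i W'))"
      using iso unfolding minimal_at_def by (simp add: order_antisym)
    then show ?thesis using p by (simp add: discriminant_of_int rat_valuation_of_int)
  qed
  then have "normalize (discriminant W) = normalize (discriminant W')"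
    using nz assms(2,3) by (intro multiplicity_eq_imp_eq)
  then show ?thesis by simp
qed

text \<open>At a prime of bad reduction the exponent is 1 or at least 2, so exactly the primes
  dividing the minimal discriminant contribute a factor.\<close>

lemma prime_dvd_conductor_iff:
  assumes "prime p" "minimal_discriminant E \<noteq> 0"
  shows "p dvd conductor E \<longleftrightarrow> int p dvd minimal_discriminant E"
proof -
  have *: "conductor_exponent E r \<noteq> 0 \<longleftrightarrow> int r dvd minimal_discriminant E" for r
    by (simp add: conductor_exponent_def good_reduction_def minimal_discriminant_def)
  let ?S = "{r. prime r \<and> int r dvd minimal_discriminant E}"
  \<comment> \<open>A product over an infinite index set would be 1 by convention; a nonzero
    discriminant has only finitely many prime divisors.\<close>
  have "r \<le> nat \<bar>minimal_discriminant E\<bar>" if "r \<in> ?S" for r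
    using that assms(2) dvd_imp_le_int[of "minimal_discriminant E" "int r"] by auto
  then have "finite ?S" by (meson finite_nat_set_iff_bounded_le)
  then have "p dvd conductor E \<longleftrightarrow> (\<exists>r\<in>?S. p dvd r ^ conductor_exponent E r)"
    unfolding conductor_def * using assms(1) by (rule prime_dvd_prod_iff)
  also have "\<dots> \<longleftrightarrow> p \<in> ?S"
  proof
    assume "\<exists>r\<in>?S. p dvd r ^ conductor_exponent E r"
    then obtain r where r: "r \<in> ?S" "p dvd r ^ conductor_exponent E r" by blast
    then have "p = r"
      using assms(1) prime_dvd_power[of p r] primes_dvd_imp_eq[of p r] by simp
    then show "p \<in> ?S" using r by simp
  next
    assume "p \<in> ?S"
    then show "\<exists>r\<in>?S. p dvd r ^ conductor_exponent E r"
      using *[of p] by (intro bexI[of _ p]) auto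
  qed
  finally show ?thesis using assms(1) by simp
qed

section \<open>The Diophantine problem\<close>

lemma dvd_125_cases:
  fixes y :: int
  assumes "y dvd 125"
  shows "y \<in> {1, 5, 25, 125, -1, -5, -25, -125}"
proof -
  have "nat \<bar>y\<bar> dvd 5 ^ 3" using assms by (simp add: nat_abs_dvd_iff)
  moreover have "prime (5 :: nat)" by simp
  ultimately obtain i where i: "i \<le> 3" "nat \<bar>y\<bar> = 5 ^ i" using divides_primepow_nat by blast
  then have "i \<in> {0, 1, 2, 3}" by auto
  with i have "\<bar>y\<bar> \<in> {1, 5, 25, 125}" by auto
  then show ?thesis by auto
qed

lemma prod_eq_125_cases:
  fixes y z :: int
  assumes "y * z = 125"
  shows "(y, z) \<in> {(1, 125), (5, 25), (25, 5), (125, 1), (-1, -125), (-5, -25), (-25, -5), (-125, -1)}"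
proof -
  have "y dvd 125" using assms by (metis dvd_triv_left)
  then have "y = 1 \<or> y = 5 \<or> y = 25 \<or> y = 125 \<or> y = -1 \<or> y = -5 \<or> y = -25 \<or> y = -125"
    using dvd_125_cases by simp
  then show ?thesis
    by (elim disjE) (use assms in simp_all)
qed

lemma odd_square_mod_8:
  fixes x :: int
  assumes "odd x"
  shows "x^2 mod 8 = 1"
proof -
  obtain y where y: "x = 2 * y + 1" using assms by (rule oddE)
  have "even (y * (y + 1))" by simp
  then obtain z where "y * (y + 1) = 2 * z" by (rule evenE)
  then have "x^2 = 8 * z + 1" by (simp add: y power2_eq_square algebra_simps)
  then show ?thesis by presburger
qed

text \<open>As \<open>w + 1\<close> is odd, all of \<open>16 ^ k\<close> divides \<open>w\<close>,
  leaving \<open>m * (16 ^ k * m + 1) = 125\<close>. Over the factorizations of 125 the only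
  positive candidates for \<open>16 ^ k\<close> are 124 and 126, which are not powers of 16.\<close>

lemma consecutive_prod_ne_even:
  fixes w :: int
  assumes "even w"
  shows "w * (w + 1) \<noteq> 125 * 16 ^ k"
proof
  assume eq: "w * (w + 1) = 125 * 16 ^ k"
  have "coprime (16 ^ k) (w + 1)"
    using assms coprime_power_left_iff[of "2::int" 4 "w + 1"] by simp
  then have "16 ^ k dvd w"
    using eq by (metis coprime_dvd_mult_left_iff dvd_triv_right)
  then obtain m where w: "w = 16 ^ k * m" by blast
  with eq have "16 ^ k * (m * (w + 1)) = 16 ^ k * 125" by (simp add: algebra_simps)
  then have "m * (w + 1) = 125" by simp
  define P :: int where "P = 16 ^ k"
  define n where "n = P * m + 1"
  have "m * n = 125" using \<open>m * (w + 1) = 125\<close> by (simp add: n_def P_def w)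
  note cases = prod_eq_125_cases[OF this]
  have "P * m + 1 = n" by (simp add: n_def)
  moreover have "m = 1 \<and> n = 125 \<or> m = 5 \<and> n = 25 \<or> m = 25 \<and> n = 5 \<or> m = 125 \<and> n = 1
    \<or> m = -1 \<and> n = -125 \<or> m = -5 \<and> n = -25 \<or> m = -25 \<and> n = -5 \<or> m = -125 \<and> n = -1"
    using cases by simp
  ultimately have "P = 124 \<or> P = 126 \<or> 5 * P = 24 \<or> 5 * P = 26 \<or> 25 * P = 4 \<or> 25 * P = 6 \<or> P = 0 \<or> 125 * P = 2"
    by (elim disjE conjE) simp_all
  moreover have "5 * P \<noteq> 24" "5 * P \<noteq> 26" "25 * P \<noteq> 4" "25 * P \<noteq> 6" "125 * P \<noteq> 2"
    by presburger+
  ultimately have "P = 124 \<or> P = 126 \<or> P = 0" by blast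
  moreover have "P = 1 \<or> 16 dvd P" "P > 0" unfolding P_def by (cases k) auto
  ultimately show False by auto
qed

text \<open>The reflection of \<open>w\<close> to \<open>- w - 1\<close> preserves the product and
  changes the parity.\<close>

lemma consecutive_prod_ne:
  fixes w :: int
  shows "w * (w + 1) \<noteq> 125 * 16 ^ k"
proof (cases "even w")
  case False
  then have "even (- w - 1)" by simp
  from consecutive_prod_ne_even[OF this, of k] show ?thesis by (simp add: algebra_simps)
qed (rule consecutive_prod_ne_even)

section \<open>The form \<open>a^2 - 11 a b - b^2\<close> at prime powers\<close>

definition tate_form :: "int \<Rightarrow> int \<Rightarrow> int" where
  "tate_form a b = a^2 - 11 * a * b - b^2"

text \<open>This symmetry exchanges the roles of \<open>a\<close> and \<open>b\<close> up to signs;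
  it halves the case distinctions below.\<close>

lemma tate_form_swap: "tate_form b (- a) = - tate_form a b"
  by (simp add: tate_form_def)

text \<open>Completing the square gives an odd \<open>y = 2 * w + 1\<close> with
  \<open>y^2 = 500 * 16 ^ k + e\<close>, where \<open>e\<close> is 1 or -1. Modulo 4 the sign is
  plus, and \<open>w * (w + 1) = 125 * 16 ^ k\<close> is impossible.\<close>

lemma tate_form_ne_unit_even:
  assumes b: "\<bar>b\<bar> = 2 ^ (2 * k + 2)"
  shows "\<bar>tate_form a b\<bar> \<noteq> 1"
proof
  assume f: "\<bar>tate_form a b\<bar> = 1"
  obtain c where c: "b = 2 * c" "\<bar>c\<bar> = 2 ^ (2 * k + 1)"
  proof -
    have "even \<bar>b\<bar>" unfolding b by simp
    then have "even b" by simp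
    then obtain c where "b = 2 * c" by blast
    then show ?thesis using that[of c] b by (simp add: abs_mult)
  qed
  have "c^2 = \<bar>c\<bar>^2" by simp
  also have "\<dots> = 2^2 * (2^4) ^ k"
    unfolding c(2) power_mult[symmetric] power_add[symmetric] by (simp add: algebra_simps)
  finally have c2: "c^2 = 4 * 16 ^ k" by simp
  \<comment> \<open>\<open>2 y\<close> completes the square: \<open>(2 a - 11 b)^2 = 125 b^2 + 4 tate_form a b\<close>\<close>
  define y where "y = a - 11 * c"
  have y: "y^2 = 500 * 16 ^ k + tate_form a b"
    using c2 by (simp add: y_def tate_form_def c(1) power2_eq_square algebra_simps)
  have "odd y"
  proof
    assume "even y"
    then have "even (y^2)" by simp
    with y f show False by (auto simp: abs_if split: if_splits)
  qed
  then obtain w where w: "y = 2 * w + 1" by (rule oddE)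
  have "4 * (w * (w + 1)) + 1 = 4 * (125 * 16 ^ k) + tate_form a b"
    using y by (simp add: w power2_eq_square algebra_simps)
  moreover have "tate_form a b = 1 \<or> tate_form a b = -1" using f by linarith
  moreover have "g = h" if "4 * g + 1 = 4 * h + e" "e = 1 \<or> e = -1" for g h e :: int
    using that by presburger
  ultimately have "w * (w + 1) = 125 * 16 ^ k" by blast
  then show False using consecutive_prod_ne by blast
qed

text \<open>If \<open>a\<close> or \<open>b\<close> is even, its prime is 2 and it is up to sign
  \<open>2 ^ (2 * k + 2)\<close>, which is excluded already. If both are odd, residues modulo 8
  decide.\<close>

lemma tate_form_ne_unit:
  fixes p q :: int
  assumes "prime p" "prime q" and a: "\<bar>a\<bar> = p ^ i" "even i" and b: "\<bar>b\<bar> = q ^ j" "even j"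
  shows "\<bar>tate_form a b\<bar> \<noteq> 1"
proof
  assume f: "\<bar>tate_form a b\<bar> = 1"
  have even_power_of_2: "\<exists>k. \<bar>x\<bar> = 2 ^ (2 * k + 2)" if "even x" "\<bar>x\<bar> = r ^ n" "even n" "prime r" for x r :: int and n
  proof -
    have "even (r ^ n)" unfolding that(2)[symmetric] using that(1) by simp
    then have "even r" "n > 0" by auto
    then have "r = 2" using that(4) primes_dvd_imp_eq[of 2 r] by simp
    obtain m where "n = 2 * m" using \<open>even n\<close> by (rule evenE)
    then have "n = 2 * (m - 1) + 2" using \<open>n > 0\<close> by simp
    then show ?thesis using that(2) \<open>r = 2\<close> by metis
  qed
  have "odd b" using even_power_of_2[OF _ b \<open>prime q\<close>] tate_form_ne_unit_even f by blast
  moreover have "odd a"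
  proof
    assume "even a"
    then obtain k where "\<bar>- a\<bar> = 2 ^ (2 * k + 2)" using even_power_of_2[OF _ a \<open>prime p\<close>] by auto
    then have "\<bar>tate_form b (- a)\<bar> \<noteq> 1" by (rule tate_form_ne_unit_even)
    then show False using f by (simp add: tate_form_swap)
  qed
  \<comment> \<open>\<open>\<bar>a b\<bar>\<close> is an odd square, so the form is 3 or 5 modulo 8\<close>
  ultimately have odd: "odd a" "odd b" by auto
  obtain i' j' where ij: "i = 2 * i'" "j = 2 * j'" using a b by (elim evenE)
  define s where "s = p ^ i' * q ^ j'"
  have "\<bar>a * b\<bar> = s^2" using a b ij by (simp add: abs_mult s_def power_mult_distrib power_mult mult.commute[of 2])
  moreover have "odd s"
  proof
    assume "even s"
    then have "even \<bar>a * b\<bar>" unfolding \<open>\<bar>a * b\<bar> = s^2\<close> by simp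
    with odd show False by simp
  qed
  ultimately have "\<bar>a * b\<bar> mod 8 = 1" by (simp add: odd_square_mod_8)
  moreover have "v mod 8 = 1 \<or> v mod 8 = 7" if "\<bar>v\<bar> mod 8 = 1" for v :: int
  proof (cases "v \<ge> 0")
    case False
    with that have "(- v) mod 8 = 1" by simp
    then show ?thesis by presburger
  qed (use that in simp)
  ultimately have "(a * b) mod 8 = 1 \<or> (a * b) mod 8 = 7" by blast
  then obtain r where r: "r = 1 \<or> r = 7" "(a * b) mod 8 = r mod 8"
  proof
    assume "(a * b) mod 8 = 1"
    then show thesis by (intro that[of 1]) simp_all
  next
    assume "(a * b) mod 8 = 7"
    then show thesis by (intro that[of 7]) simp_all
  qed
  have "a^2 mod 8 = 1 mod 8" "b^2 mod 8 = 1 mod 8" using odd by (simp_all add: odd_square_mod_8)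
  with r(2) have 8: "8 dvd a^2 - 1" "8 dvd a * b - r" "8 dvd b^2 - 1" by (simp_all only: mod_eq_dvd_iff)
  have "8 dvd (a^2 - 1) - 11 * (a * b - r) - (b^2 - 1)"
    by (rule dvd_diff[OF dvd_diff[OF 8(1) dvd_mult[OF 8(2)]] 8(3)])
  moreover have "(a^2 - 1) - 11 * (a * b - r) - (b^2 - 1) = tate_form a b + 11 * r"
    by (simp add: tate_form_def)
  ultimately have "8 dvd tate_form a b + 11 * r" by (simp only:)
  moreover have "tate_form a b = 1 \<or> tate_form a b = -1" using f by linarith
  ultimately show False using r(1) by auto
qed

text \<open>The equation is \<open>(2 x - 11)^2 - 125 = 4 s^2\<close> or \<open>(2 x - 11)^2 - 125 = - 4 s^2\<close>.\<close>

lemma tate_form_square_cases: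
  fixes x p s :: int
  assumes "prime p" "\<bar>x\<bar> = p ^ i" "\<bar>x^2 - 11 * x - 1\<bar> = s^2" "s \<ge> 2"
  shows "\<bar>x\<bar>^5 * s^2 \<in> {2^5 * 5^2, 2^15 * 5^2, 3^5 * 5^2, 13^5 * 5^2, 37^5 * 31^2}"
proof (cases "x^2 - 11 * x - 1 \<ge> 0")
  case True
  then have "(2 * x - 11 + 2 * s) * (2 * x - 11 - 2 * s) = 125"
    using assms(3) by (simp add: power2_eq_square algebra_simps)
  moreover define y z where "y = 2 * x - 11 + 2 * s" and "z = 2 * x - 11 - 2 * s"
  ultimately have "y * z = 125" by simp
  then have "y = 1 \<and> z = 125 \<or> y = 5 \<and> z = 25 \<or> y = 25 \<and> z = 5 \<or> y = 125 \<and> z = 1 \<or>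
    y = -1 \<and> z = -125 \<or> y = -5 \<and> z = -25 \<or> y = -25 \<and> z = -5 \<or> y = -125 \<and> z = -1"
    using prod_eq_125_cases[of y z] by simp
  moreover have "4 * x = y + z + 22" "4 * s = y - z" by (simp_all add: y_def z_def)
  \<comment> \<open>The other four factorizations give a negative \<open>s\<close>.\<close>
  ultimately have "x = 37 \<and> s = 31 \<or> x = 13 \<and> s = 5 \<or> x = -26 \<and> s = 31 \<or> x = -2 \<and> s = 5"
    using assms(4) by (elim disjE conjE) simp_all
  \<comment> \<open>26 is not a prime power.\<close>
  moreover have "x \<noteq> -26"
  proof
    assume "x = -26"
    with assms(2) have e: "p ^ i = 26" by simp
    have "2 dvd p ^ i" "13 dvd p ^ i" unfolding e by auto
    moreover have "prime (2::int)" "prime (13::int)" by simp_all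
    ultimately have "2 dvd p" "13 dvd p" using prime_dvd_power by blast+
    then have "p = 2" "p = 13" using primes_dvd_imp_eq[of 2 p] primes_dvd_imp_eq[of 13 p] \<open>prime 13\<close> assms(1) by auto
    then show False by simp
  qed
  ultimately show ?thesis by auto
next
  case False
  \<comment> \<open>The left side must be at least 4, so \<open>x\<close> lies between 1 and 10; a
    square occurs only for \<open>x = 3\<close> and \<open>x = 8\<close>, with
    \<open>s = 5\<close>.\<close>
  then have e: "x * (11 - x) + 1 = s^2"
    using assms(3) by (simp add: power2_eq_square algebra_simps)
  have "s^2 \<ge> 2^2" using assms(4) by (intro power_mono) auto
  with e have "x * (11 - x) > 0" by simp
  then have x: "x > 0" "x < 11" by (auto simp: zero_less_mult_iff)
  then have "x \<in> {1, 2, 3, 4, 5, 6, 7, 8, 9, 10}"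
    unfolding insert_iff empty_iff by presburger
  moreover have "s < 6"
  proof (rule ccontr)
    assume "\<not> s < 6"
    then have "s^2 \<ge> 6^2" by (intro power_mono) auto
    moreover have "x * (11 - x) + 1 \<le> 31" using \<open>x \<in> _\<close> by auto
    ultimately show False using e by simp
  qed
  then have "s \<in> {2, 3, 4, 5}" using assms(4) by auto
  ultimately show ?thesis using e by auto
qed

section \<open>Distribution of the two primes over the factors of the discriminant\<close>

lemma abs_eq_prime_power:
  fixes n p :: int
  assumes "n \<noteq> 0" "prime p" "\<And>r. prime r \<Longrightarrow> r dvd n \<Longrightarrow> r = p"
  obtains k where "\<bar>n\<bar> = p ^ k"
proof -
  obtain y where y: "n = p ^ multiplicity p n * y" "\<not> p dvd y"
    using multiplicity_decompose'[of n p] assms(1,2) by (metis not_prime_unit)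
  have "is_unit y"
  proof (rule ccontr)
    assume "\<not> is_unit y"
    then obtain r where "r dvd y" "prime r" using prime_divisor_exists[of y] y assms(1) by auto
    with assms(3)[of r] y show False by (metis dvd_mult)
  qed
  then have "\<bar>n\<bar> = p ^ multiplicity p n"
    using arg_cong[OF y(1), of abs] prime_ge_0_int[OF assms(2)] by (simp add: abs_mult power_abs)
  then show ?thesis by (rule that)
qed

text \<open>The conclusion of the theorem as a predicate symmetric in \<open>p\<close> and
  \<open>q\<close>, so that cases differing by names can be merged.\<close>

definition listed_discriminant :: "int \<Rightarrow> int \<Rightarrow> int \<Rightarrow> bool" where
  "listed_discriminant p q D \<longleftrightarrow> D \<in> {2^5 * 5^2, 2^15 * 5^2, 3^5 * 5^2, 13^5 * 5^2, 37^5 * 31^2, 7^5 * 5^3} \<or>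
     (\<exists>k l :: nat. D = p ^ (5 * k) * q ^ (2 * l + 1)) \<or>
     (\<exists>k l :: nat. D = q ^ (5 * k) * p ^ (2 * l + 1))"

lemma listed_discriminant_commute: "listed_discriminant p q D \<longleftrightarrow> listed_discriminant q p D"
  unfolding listed_discriminant_def by blast

definition tate_discriminant :: "int \<Rightarrow> int \<Rightarrow> int" where
  "tate_discriminant a b = a^5 * b^5 * tate_form a b"

lemma tate_discriminant_swap: "tate_discriminant b (- a) = tate_discriminant a b"
  by (simp add: tate_discriminant_def tate_form_swap)

text \<open>An odd \<open>n\<close> gives a member of the infinite family. For even
  \<open>n\<close>, \<open>b^2 = 1\<close> turns the form into \<open>x^2 - 11 * x - 1\<close> at
  \<open>x = a * b\<close>, a square up to sign, and the finite list results.\<close>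

lemma listed_discriminant_unit:
  assumes "prime p" "prime q" "\<bar>a\<bar> = p ^ i" "\<bar>b\<bar> = 1" "\<bar>tate_form a b\<bar> = q ^ n" "n > 0"
  shows "listed_discriminant p q \<bar>tate_discriminant a b\<bar>"
proof -
  have D: "\<bar>tate_discriminant a b\<bar> = \<bar>a\<bar>^5 * q ^ n"
    using assms(4,5) by (simp add: tate_discriminant_def abs_mult power_abs)
  show ?thesis
  proof (cases "even n")
    case True
    then obtain m where m: "n = 2 * m" by (rule evenE)
    have "m > 0" using m assms(6) by simp
    have "b^2 = 1" using assms(4) by (metis power2_abs one_power2)
    then have x: "tate_form a b = (a * b)^2 - 11 * (a * b) - 1" "\<bar>a * b\<bar> = p ^ i"
      using assms(3,4) by (simp_all add: tate_form_def power_mult_distrib abs_mult)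
    have "2 \<le> q" using assms(2) by (rule prime_ge_2_int)
    also have "q \<le> q ^ m" using \<open>m > 0\<close> \<open>2 \<le> q\<close> by (intro self_le_power) auto
    finally have "\<bar>a * b\<bar>^5 * (q ^ m)^2 \<in> {2^5 * 5^2, 2^15 * 5^2, 3^5 * 5^2, 13^5 * 5^2, 37^5 * 31^2}"
      using assms(5) x m by (intro tate_form_square_cases[OF assms(1)]) (auto simp: power_mult mult.commute[of 2])
    moreover have "\<bar>a * b\<bar>^5 * (q ^ m)^2 = \<bar>tate_discriminant a b\<bar>"
      unfolding D using assms(4) m by (simp add: abs_mult power_mult mult.commute[of 2])
    ultimately show ?thesis unfolding listed_discriminant_def by auto
  next
    case False
    then obtain m where "n = 2 * m + 1" by (rule oddE)
    then have "\<bar>tate_discriminant a b\<bar> = p ^ (5 * i) * q ^ (2 * m + 1)"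
      unfolding D assms(3) by (simp flip: power_mult add: mult.commute)
    then show ?thesis unfolding listed_discriminant_def by blast
  qed
qed

text \<open>The exponents \<open>i\<close> and \<open>j\<close> are not both even; five times an odd
  one serves as \<open>2 * l + 1\<close>, and the other one as \<open>k\<close>.\<close>

lemma listed_discriminant_prime_powers:
  assumes "prime p" "prime q" "\<bar>a\<bar> = p ^ i" "\<bar>b\<bar> = q ^ j" "\<bar>tate_form a b\<bar> = 1"
  shows "listed_discriminant p q \<bar>tate_discriminant a b\<bar>"
proof -
  have D: "\<bar>tate_discriminant a b\<bar> = p ^ (5 * i) * q ^ (5 * j)"
    using assms by (simp add: tate_discriminant_def abs_mult power_abs mult.commute flip: power_mult)
  have "odd (5 * i) \<or> odd (5 * j)" using tate_form_ne_unit[OF assms(1,2,3) _ assms(4)] assms(5) by auto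
  then show ?thesis unfolding listed_discriminant_def D by (metis oddE mult.commute)
qed

text \<open>Since \<open>b^2 = 1\<close>, the product \<open>a * (a - 11 * b)\<close> is 0 or 2, and
  no divisor \<open>a\<close> of 2 gives 2. As 11 is prime, \<open>a\<close> cannot then absorb two
  distinct primes.\<close>

lemma tate_form_unit_unit:
  assumes "\<bar>b\<bar> = 1" "\<bar>tate_form a b\<bar> = 1" "a \<noteq> 0"
  shows "\<bar>a\<bar> = 11"
proof -
  have "b = 1 \<or> b = -1" using assms(1) by linarith
  moreover have "a * (a - 11 * b) = tate_form a b + b^2"
    by (simp add: tate_form_def power2_eq_square algebra_simps)
  ultimately have "a * (a - 11 * b) = 0 \<or> a * (a - 11 * b) = 2"
    using assms(2) by (auto simp: abs_if split: if_splits)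
  then show ?thesis
  proof
    assume "a * (a - 11 * b) = 0"
    then show ?thesis using assms(1,3) by (auto simp: abs_mult)
  next
    assume e: "a * (a - 11 * b) = 2"
    then have "a dvd 2" by (metis dvd_triv_left)
    then have "\<bar>a\<bar> \<le> 2" using dvd_imp_le_int[of 2 a] by simp
    then have "a \<in> {-2, -1, 0, 1, 2}" by auto
    with e \<open>b = 1 \<or> b = -1\<close> show ?thesis by auto
  qed
qed


text \<open>The cases are which of the pairwise coprime factors \<open>a\<close>, \<open>b\<close>
  and \<open>tate_form a b\<close> each of \<open>p\<close> and \<open>q\<close> divides. Both
  primes in one factor would make that factor 11 up to sign.\<close>

lemma listed_discriminant_tate_discriminant:
  assumes cop: "coprime a b" and "a \<noteq> 0" "b \<noteq> 0" and p: "prime p" and q: "prime q" and "p \<noteq> q"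
    and r: "\<And>r. prime r \<Longrightarrow> r dvd tate_discriminant a b \<longleftrightarrow> r = p \<or> r = q"
  shows "listed_discriminant p q \<bar>tate_discriminant a b\<bar>"
proof -
  let ?f = "tate_form a b"
  \<comment> \<open>Otherwise the discriminant is 0 and has the three prime divisors 2, 3 and
    5.\<close>
  have "?f \<noteq> 0"
  proof
    assume "?f = 0"
    then have "3 = p \<or> 3 = q" "2 = p \<or> 2 = q" "5 = p \<or> 5 = q"
      using r[of 3] r[of 2] r[of 5] by (simp_all add: tate_discriminant_def)
    then show False by auto
  qed
  have dvd: "r dvd tate_discriminant a b \<longleftrightarrow> r dvd a \<or> r dvd b \<or> r dvd ?f" if "prime r" for r
    using that by (auto simp: tate_discriminant_def prime_dvd_mult_iff prime_dvd_power_iff)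
  have excl: "\<not> (r dvd a \<and> r dvd b)" "\<not> (r dvd a \<and> r dvd ?f)" "\<not> (r dvd b \<and> r dvd ?f)" if "prime r" for r
  proof -
    show 1: "\<not> (r dvd a \<and> r dvd b)"
      using cop that by (metis coprime_common_divisor not_prime_unit)
    have "b * b = a * (a - 11 * b) - ?f" "a * a = b * (b + 11 * a) + ?f"
      by (simp_all add: tate_form_def power2_eq_square algebra_simps)
    then have "r dvd a \<and> r dvd ?f \<Longrightarrow> r dvd b * b" "r dvd b \<and> r dvd ?f \<Longrightarrow> r dvd a * a"
      by simp_all
    then show "\<not> (r dvd a \<and> r dvd ?f)" "\<not> (r dvd b \<and> r dvd ?f)"
      using 1 that by (auto simp: prime_dvd_mult_iff)
  qed
  \<comment> \<open>A factor missing one of the two primes is up to sign a power of the other;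
    \<open>p'\<close> and \<open>q'\<close> stand for the two primes in either order.\<close>
  have pp: thesis if "p' = p \<and> q' = q \<or> p' = q \<and> q' = p" "n \<noteq> 0" "n dvd tate_discriminant a b" "\<not> q' dvd n"
    "\<And>k. \<bar>n\<bar> = p' ^ k \<Longrightarrow> thesis" for n p' q' thesis
    using that abs_eq_prime_power[of n p'] p q r by (metis dvd_trans)
  have unit: "\<bar>n\<bar> = 1" if "n \<noteq> 0" "n dvd tate_discriminant a b" "\<not> p dvd n" "\<not> q dvd n" for n
  proof (rule ccontr)
    assume "\<bar>n\<bar> \<noteq> 1"
    then obtain r where "prime r" "r dvd n" using prime_divisor_exists[of n] \<open>n \<noteq> 0\<close> by auto
    then show False using r that by (metis dvd_trans)
  qed
  have dvds: "a dvd tate_discriminant a b" "b dvd tate_discriminant a b" "?f dvd tate_discriminant a b"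
    by (simp_all add: tate_discriminant_def power_numeral_reduce)
  note ppa = pp[OF _ \<open>a \<noteq> 0\<close> dvds(1)] and ppb = pp[OF _ \<open>b \<noteq> 0\<close> dvds(2)] and ppf = pp[OF _ \<open>?f \<noteq> 0\<close> dvds(3)]
  note ua = unit[OF \<open>a \<noteq> 0\<close> dvds(1)] and ub = unit[OF \<open>b \<noteq> 0\<close> dvds(2)] and uf = unit[OF \<open>?f \<noteq> 0\<close> dvds(3)]
  have not_both_11: False if "p dvd x" "q dvd x" "\<bar>x\<bar> = 11" for x
  proof -
    have "p dvd 11" "q dvd 11" using that by (metis dvd_abs_iff)+
    then have "p = 11" "q = 11" using p q primes_dvd_imp_eq[of _ "11::int"] by simp_all
    with \<open>p \<noteq> q\<close> show False by simp
  qed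
  have one_in_form: "listed_discriminant p' q' \<bar>tate_discriminant a b\<bar>"
    if pq: "p' = p \<and> q' = q \<or> p' = q \<and> q' = p" and "q' dvd ?f" "\<not> p' dvd ?f" for p' q'
  proof -
    have p'q': "prime p'" "prime q'" "p' dvd tate_discriminant a b" using pq p q r by auto
    have "\<not> q' dvd a" "\<not> q' dvd b" using excl[OF p'q'(2)] that by blast+
    obtain n where n: "\<bar>?f\<bar> = q' ^ n" using ppf[of q' p'] pq \<open>\<not> p' dvd ?f\<close> by blast
    have "n > 0"
    proof (rule ccontr)
      assume "\<not> n > 0"
      then have "is_unit ?f" using n by simp
      then show False using that(2) p'q'(2) by (metis dvd_trans not_prime_unit)
    qed
    obtain i j where ij: "\<bar>a\<bar> = p' ^ i" "\<bar>b\<bar> = p' ^ j"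
      using ppa[of p' q'] ppb[of p' q'] pq \<open>\<not> q' dvd a\<close> \<open>\<not> q' dvd b\<close> by metis
    show ?thesis
    proof (cases "p' dvd a")
      case True
      then have "\<bar>b\<bar> = 1" using ub pq excl[OF p'q'(1)] \<open>\<not> q' dvd b\<close> by blast
      then show ?thesis using listed_discriminant_unit p'q'(1,2) ij(1) n \<open>n > 0\<close> by blast
    next
      case False
      then have "\<bar>- a\<bar> = 1" using ua pq \<open>\<not> q' dvd a\<close> by auto
      \<comment> \<open>Here \<open>a\<close> is the unit, so the pair \<open>(b, - a)\<close> takes
        the place of \<open>(a, b)\<close>.\<close>
      moreover have "\<bar>tate_form b (- a)\<bar> = q' ^ n" using n by (simp add: tate_form_swap)
      ultimately show ?thesis
        using listed_discriminant_unit[OF p'q'(1,2) ij(2) _ _ \<open>n > 0\<close>, of "- a"] by (simp add: tate_discriminant_swap)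
    qed
  qed
  have unit_form: "listed_discriminant p' q' \<bar>tate_discriminant a b\<bar>"
    if pq: "p' = p \<and> q' = q \<or> p' = q \<and> q' = p" and "\<bar>?f\<bar> = 1" "p' dvd a" "q' dvd b" for p' q'
  proof -
    have p'q': "prime p'" "prime q'" using pq p q by auto
    have "\<not> q' dvd a" "\<not> p' dvd b" using excl p'q' that by blast+
    then obtain i j where ij: "\<bar>a\<bar> = p' ^ i" "\<bar>b\<bar> = q' ^ j"
      using ppa[of p' q'] ppb[of q' p'] pq by metis
    then show ?thesis using listed_discriminant_prime_powers p'q' \<open>\<bar>?f\<bar> = 1\<close> by blast
  qed
  have p_dvd: "p dvd a \<or> p dvd b \<or> p dvd ?f" and q_dvd: "q dvd a \<or> q dvd b \<or> q dvd ?f"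
    using dvd r p q by blast+
  consider "p dvd ?f" "q dvd ?f" | "p dvd ?f" "\<not> q dvd ?f" | "\<not> p dvd ?f" "q dvd ?f" | "\<not> p dvd ?f" "\<not> q dvd ?f"
    by blast
  then show ?thesis
  proof cases
    case 1
    then have "\<bar>a\<bar> = 1" "\<bar>b\<bar> = 1" using excl[OF p] excl[OF q] ua ub by blast+
    then have "a = 1 \<or> a = -1" "b = 1 \<or> b = -1" by linarith+
    then have "\<bar>?f\<bar> = 11" by (auto simp: tate_form_def)
    then show ?thesis using not_both_11 1 by blast
  next
    case 2
    then show ?thesis using one_in_form[of q p] listed_discriminant_commute by blast
  next
    case 3
    then show ?thesis using one_in_form[of p q] by blast
  next
    case 4
    then have f1: "\<bar>?f\<bar> = 1" by (rule uf)
    consider "p dvd a" "q dvd a" | "p dvd b" "q dvd b" | "p dvd a" "q dvd b" | "q dvd a" "p dvd b"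
      using p_dvd q_dvd 4 by blast
    then show ?thesis
    proof cases
      case 1
      then have "\<bar>b\<bar> = 1" using excl[OF p] excl[OF q] ub by blast
      then have "\<bar>a\<bar> = 11" using tate_form_unit_unit f1 \<open>a \<noteq> 0\<close> by blast
      then show ?thesis using not_both_11 1 by blast
    next
      case 2
      then have "\<bar>- a\<bar> = 1" using excl[OF p] excl[OF q] ua by simp
      then have "\<bar>b\<bar> = 11" using tate_form_unit_unit[of "- a" b] f1 \<open>b \<noteq> 0\<close> by (simp add: tate_form_swap)
      then show ?thesis using not_both_11 2 by blast
    next
      case 3
      then show ?thesis using unit_form[of p q] f1 by blast
    next
      case 4
      then show ?thesis using unit_form[of q p] f1 listed_discriminant_commute by blast
    qed
  qed
qed

section \<open>Curves with a rational point of order 5\<close>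

text \<open>The normal form with parameter \<open>d = a / b\<close>, rescaled by
  \<open>u = 1 / b\<close> to clear denominators.\<close>

definition tate_curve :: "int \<Rightarrow> int \<Rightarrow> int weierstrass" where
  "tate_curve a b = Weierstrass (b - a) (- (a * b)) (- (a * b^2)) 0 0"

lemma discriminant_tate_curve: "discriminant (tate_curve a b) = tate_discriminant a b"
  by (simp add: tate_curve_def tate_discriminant_def tate_form_def Let_def algebra_simps numeral_eq_Suc)

text \<open>Division with remainder by \<open>tate_form a b\<close> in the variable
  \<open>a\<close>: modulo the form only the last term survives.\<close>

lemma c4_tate_curve:
  "c4 (tate_curve a b) = tate_form a b * (a^2 - a * b + 4 * b^2) + 5 * b^3 * (11 * a + b)"
  by (simp add: tate_curve_def tate_form_def algebra_simps numeral_eq_Suc)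

text \<open>
  Modulo a common divisor of \<open>c4\<close> and \<open>tate_form a b\<close> prime to \<open>b\<close>, both \<open>5 (11 a + b)\<close> and
  \<open>(11 a + b) (11 a - 122 b) + b^2\<close> vanish; the factor 5 is the reason for using \<open>p^4\<close>.
\<close>

lemma tate_curve_minimal_at:
  assumes cop: "coprime a b" and "tate_discriminant a b \<noteq> 0" and "prime p"
  shows "minimal_at p (map_weierstrass of_int (tate_curve a b))"
proof (rule minimal_at_of_int)
  let ?p = "int p" and ?f = "tate_form a b"
  have p: "prime ?p" using \<open>prime p\<close> by simp
  show "discriminant (tate_curve a b) \<noteq> 0"
    using assms(2) by (simp add: discriminant_tate_curve)
  show "\<not> (?p ^ 4 dvd c4 (tate_curve a b) \<and> ?p ^ 12 dvd discriminant (tate_curve a b))"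
  proof
    assume "?p ^ 4 dvd c4 (tate_curve a b) \<and> ?p ^ 12 dvd discriminant (tate_curve a b)"
    then have c: "?p ^ 4 dvd c4 (tate_curve a b)" and D: "?p ^ 12 dvd a^5 * b^5 * ?f"
      by (auto simp: discriminant_tate_curve tate_discriminant_def)
    have pc: "?p dvd c4 (tate_curve a b)" using c by (rule dvd_trans[rotated]) simp
    have ab: "\<not> (?p dvd a \<and> ?p dvd b)" using cop p by (metis coprime_common_divisor not_prime_unit)
    \<comment> \<open>\<open>c4\<close> is \<open>b^4\<close> modulo \<open>a\<close> and
      \<open>a^4\<close> modulo \<open>b\<close>, so a prime dividing \<open>c4\<close> and one of
      them divides both.\<close>
    have "\<not> ?p dvd a"
    proof
      assume "?p dvd a"
      moreover have "c4 (tate_curve a b) = a * (a^3 - 12 * a^2 * b + 14 * a * b^2 + 12 * b^3) + b^4"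
        by (simp add: c4_tate_curve tate_form_def algebra_simps numeral_eq_Suc)
      ultimately have "?p dvd b^4" using pc by (simp add: dvd_add_right_iff)
      then have "?p dvd b" using p prime_dvd_power by blast
      with \<open>?p dvd a\<close> ab show False by blast
    qed
    moreover have "\<not> ?p dvd b"
    proof
      assume "?p dvd b"
      moreover have "c4 (tate_curve a b) = b * (- 12 * a^3 + 14 * a^2 * b + 12 * a * b^2 + b^3) + a^4"
        by (simp add: c4_tate_curve tate_form_def algebra_simps numeral_eq_Suc)
      ultimately have "?p dvd a^4" using pc by (simp add: dvd_add_right_iff)
      then have "?p dvd a" using p prime_dvd_power by blast
      with \<open>?p dvd b\<close> ab show False by blast
    qed
    ultimately have "coprime ?p a" "coprime ?p b" using p prime_imp_coprime by blast+
    then have "coprime (?p ^ 12) (a^5 * b^5)" "coprime (?p ^ 4) (b^3)" by simp_all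
    then have "?p ^ 12 dvd ?f" using D by (simp add: coprime_dvd_mult_right_iff)
    then have f: "?p ^ 4 dvd ?f" by (rule dvd_trans[rotated]) (simp add: le_imp_power_dvd)
    then have "?p ^ 4 dvd ?f * (a^2 - a * b + 4 * b^2)" by (rule dvd_mult2)
    with c have "?p ^ 4 dvd 5 * b^3 * (11 * a + b)"
      unfolding c4_tate_curve by (simp add: dvd_add_right_iff)
    then have "?p ^ 4 dvd b^3 * (5 * (11 * a + b))" by (simp add: algebra_simps)
    then have 5: "?p ^ 4 dvd 5 * (11 * a + b)"
      using \<open>coprime (?p ^ 4) (b^3)\<close> by (simp add: coprime_dvd_mult_right_iff)
    have "?p dvd 11 * a + b"
    proof (rule ccontr)
      assume "\<not> ?p dvd 11 * a + b"
      then have "coprime (?p ^ 4) (11 * a + b)" using prime_imp_coprime[OF p] by simp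
      then have "?p ^ 4 dvd 5" using 5 coprime_dvd_mult_left_iff by blast
      then have "?p ^ 4 \<le> 5" by (rule zdvd_imp_le) simp
      moreover have "?p ^ 4 \<ge> 2 ^ 4" using prime_ge_2_int[OF p] by (intro power_mono) auto
      ultimately show False by simp
    qed
    moreover have "?p dvd ?f" using f by (rule dvd_trans[rotated]) simp
    moreover have "b^2 = 121 * ?f - (11 * a + b) * (11 * a - 122 * b)"
      by (simp add: tate_form_def algebra_simps power2_eq_square)
    ultimately have "?p dvd b^2" by simp
    then show False using p prime_dvd_power \<open>\<not> ?p dvd b\<close> by blast
  qed
qed fact

text \<open>\<open>tate_curve a b\<close> witnesses that a global minimal model exists, so the
  chosen \<open>minimal_model E\<close> is one too, and the two have the same absolute
  discriminant.\<close>

lemma five_torsion_minimal_discriminant: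
  assumes "elliptic_curve E" "torsion E 5 \<noteq> {Infinity}"
  obtains a b :: int where "coprime a b" "a \<noteq> 0" "b \<noteq> 0" "tate_discriminant a b \<noteq> 0"
    "\<bar>minimal_discriminant E\<bar> = \<bar>tate_discriminant a b\<bar>"
proof -
  obtain d where d: "d \<noteq> 0" "isomorphic E (Weierstrass (1 - d) (- d) (- d) 0 0)"
    using five_torsion_Tate_normal_form[OF assms(2)] .
  obtain a b where q: "quotient_of d = (a, b)" by fastforce
  note q = quotient_of_eq_divide[OF q]
  let ?W = "map_weierstrass of_int (tate_curve a b) :: rat weierstrass"
  have "a \<noteq> 0" "b \<noteq> 0" using q d(1) by auto
  have "change_variables (1 / of_int b) 0 0 0 (Weierstrass (1 - d) (- d) (- d) 0 0) = ?W"
    using \<open>b \<noteq> 0\<close> by (simp add: tate_curve_def q(1) field_simps power2_eq_square power3_eq_cube)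
  then have "isomorphic (Weierstrass (1 - d) (- d) (- d) 0 0) ?W"
    unfolding isomorphic_def using \<open>b \<noteq> 0\<close> by (metis divide_eq_0_iff of_int_eq_0_iff zero_neq_one)
  with d(2) have iso: "isomorphic E ?W" by (rule isomorphic_trans)
  then obtain u r s t where "u \<noteq> 0" "?W = change_variables u r s t E" unfolding isomorphic_def by blast
  then have "u^12 * discriminant ?W = discriminant E" by (simp add: discriminant_change_variables)
  then have nz: "tate_discriminant a b \<noteq> 0"
    using assms(1) by (auto simp: elliptic_curve_def discriminant_of_int discriminant_tate_curve)
  have "global_minimal_model E (tate_curve a b)"
    unfolding global_minimal_model_def using iso tate_curve_minimal_at[OF q(3) nz] by blast
  moreover from this have "global_minimal_model E (minimal_model E)"
    unfolding minimal_model_def by (rule someI)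
  ultimately have "\<bar>minimal_discriminant E\<bar> = \<bar>tate_discriminant a b\<bar>"
    using global_minimal_model_abs_discriminant_eq[OF assms(1)]
    unfolding minimal_discriminant_def discriminant_tate_curve[symmetric] by blast
  then show ?thesis using that q(3) \<open>a \<noteq> 0\<close> \<open>b \<noteq> 0\<close> nz by blast
qed

theorem theorem3p3:
  fixes E :: "rat weierstrass" and p q \<alpha> \<beta> :: nat
  assumes "elliptic_curve E"
    and "torsion E 5 \<noteq> {Infinity}"
    and "prime p" and "prime q" and "p \<noteq> q"
    and "\<alpha> > 0" and "\<beta> > 0"
    and "conductor E = p ^ \<alpha> * q ^ \<beta>"
  shows "\<bar>minimal_discriminant E\<bar> \<in>
           {2^5 * 5^2, 2^15 * 5^2, 3^5 * 5^2, 13^5 * 5^2, 37^5 * 31^2, 7^5 * 5^3} \<or>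
         (\<exists>k l :: nat. \<bar>minimal_discriminant E\<bar> = int p ^ (5 * k) * int q ^ (2 * l + 1)) \<or>
         (\<exists>k l :: nat. \<bar>minimal_discriminant E\<bar> = int q ^ (5 * k) * int p ^ (2 * l + 1))"
proof -
  obtain a b :: int where ab: "coprime a b" "a \<noteq> 0" "b \<noteq> 0" "tate_discriminant a b \<noteq> 0"
    and D: "\<bar>minimal_discriminant E\<bar> = \<bar>tate_discriminant a b\<bar>"
    using five_torsion_minimal_discriminant[OF assms(1,2)] .
  have nz: "minimal_discriminant E \<noteq> 0" using D ab(4) by auto
  \<comment> \<open>The conductor and the minimal discriminant have the same prime divisors; as both
    exponents are positive, \<open>p\<close> and \<open>q\<close> really occur.\<close>
  have "r dvd tate_discriminant a b \<longleftrightarrow> r = int p \<or> r = int q" if "prime r" for r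
  proof -
    obtain m where m: "r = int m" "prime m"
    proof (rule that)
      show "r = int (nat r)" using prime_gt_0_int[OF \<open>prime r\<close>] by simp
      show "prime (nat r)" using \<open>prime r\<close> prime_int_nat_transfer by blast
    qed
    have "r dvd tate_discriminant a b \<longleftrightarrow> r dvd minimal_discriminant E"
      using D by (metis dvd_abs_iff)
    also have "\<dots> \<longleftrightarrow> m dvd p ^ \<alpha> * q ^ \<beta>"
      using prime_dvd_conductor_iff[OF m(2) nz] assms(8) m(1) by simp
    also have "\<dots> \<longleftrightarrow> m = p \<or> m = q"
      using m(2) assms(3,4,6,7) primes_dvd_imp_eq by (auto simp: prime_dvd_mult_iff prime_dvd_power_iff)
    finally show ?thesis by (simp add: m(1))
  qed
  then have "listed_discriminant (int p) (int q) \<bar>tate_discriminant a b\<bar>"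
    using assms(3-5) ab by (intro listed_discriminant_tate_discriminant) simp_all
  then show ?thesis unfolding listed_discriminant_def D .
qed

end
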